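(* Let $(V,\leq)$ be a partially ordered set, $k\ge 1$, $\tau:\{1,\ldots,k\}\to\{-1,1\}$, and let $F:V^k\to V$ be increasing with respect to $\leq_\tau$, i.e. $X\leq_\tau Y\Rightarrow F(X)\leq F(Y)$ for all $X,Y\in V^k$. Then the map $G_\tau:V^k\times V^k\to V^k\times V^k$ is increasing with respect to the partial order $\leq_\lambda$ on $V^k\times V^k$, i.e. $(X,U)\leq_\lambda(Y,W)\Rightarrow G_\tau(X,U)\leq_\lambda G_\tau(Y,W)$.
   Context: The ordering $\leq_\tau$ on $V^k$ is: $(x_1,\ldots,x_k)\leq_\tau(y_1,\ldots,y_k)$ iff for all $i$, $x_i\le y_i$ when $\tau(i)=1$ and $x_i\ge y_i$ when $\tau(i)=-1$. The order $\leq_\lambda$ on $V^k\times V^k$ is: $(X_1,U_1)\leq_\lambda(X_2,U_2)$ iff $X_1\leq_\tau X_2$ and $U_2\leq_\tau U_1$. The map $G_\tau$ is defined, for $X=(x_1,\ldots,x_k)$ and $U=(u_1,\ldots,u_k)$ in $V^k$, as follows. For $1\le i\le k-1$ put $y_{i+1}=x_i$, $z_{i+1}=u_i$ if $\tau(i)\tau(i+1)=1$, and $y_{i+1}=u_i$, $z_{i+1}=x_i$ if $\tau(i)\tau(i+1)=-1$. If $\tau(1)=1$, then $G_\tau(X,U)=(F(X),y_2,\ldots,y_k,\;F(U),z_2,\ldots,z_k)$. If $\tau(1)=-1$, then $G_\tau(X,U)=(F(U),y_2,\ldots,y_k,\;F(X),z_2,\ldots,z_k)$. *)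

theory Defs
  imports Main "HOL-Library.FuncSet"
begin

text \<open>The poset \<open>V\<close> is a type of class \<^class>\<open>order\<close>. The elements of \<open>V\<^sup>k\<close> are the functions on
  \<^typ>\<open>nat\<close> that are unconstrained on \<open>{1..k}\<close> and equal to \<^const>\<open>undefined\<close> elsewhere, so that
  equality of functions is equality of tuples.\<close>

definition tuples :: "nat \<Rightarrow> (nat \<Rightarrow> 'a) set"
  where "tuples k = {1..k} \<rightarrow>\<^sub>E UNIV"

definition le_tau :: "nat \<Rightarrow> (nat \<Rightarrow> int) \<Rightarrow> (nat \<Rightarrow> 'a::order) \<Rightarrow> (nat \<Rightarrow> 'a) \<Rightarrow> bool"
  where "le_tau k \<tau> X Y \<longleftrightarrow>
    (\<forall>i\<in>{1..k}. (\<tau> i = 1 \<longrightarrow> X i \<le> Y i) \<and> (\<tau> i = -1 \<longrightarrow> X i \<ge> Y i))"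

definition le_lambda ::
    "nat \<Rightarrow> (nat \<Rightarrow> int) \<Rightarrow> (nat \<Rightarrow> 'a::order) \<times> (nat \<Rightarrow> 'a) \<Rightarrow> (nat \<Rightarrow> 'a) \<times> (nat \<Rightarrow> 'a) \<Rightarrow> bool"
  where "le_lambda k \<tau> = (\<lambda>(X1, U1) (X2, U2). le_tau k \<tau> X1 X2 \<and> le_tau k \<tau> U2 U1)"

text \<open>\<open>shift \<tau> X U j\<close> is \<open>y\<^sub>j\<close> for \<open>j \<ge> 2\<close> (the index is shifted by one: \<open>j = i + 1\<close>). Exchanging \<open>X\<close> and
  \<open>U\<close> exchanges \<open>y\<close> and \<open>z\<close>, so \<open>z\<^sub>j\<close> is \<open>shift \<tau> U X j\<close>. The \<open>else\<close> branch is the case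
  \<open>\<tau>(i)\<tau>(i+1) = -1\<close>, as \<open>\<tau>\<close> takes values in \<open>{-1, 1}\<close>.\<close>

definition shift :: "(nat \<Rightarrow> int) \<Rightarrow> (nat \<Rightarrow> 'a) \<Rightarrow> (nat \<Rightarrow> 'a) \<Rightarrow> nat \<Rightarrow> 'a"
  where "shift \<tau> X U j = (if \<tau> (j - 1) * \<tau> j = 1 then X (j - 1) else U (j - 1))"

definition G_tau ::
    "nat \<Rightarrow> (nat \<Rightarrow> int) \<Rightarrow> ((nat \<Rightarrow> 'a) \<Rightarrow> 'a) \<Rightarrow>
      (nat \<Rightarrow> 'a) \<times> (nat \<Rightarrow> 'a) \<Rightarrow> (nat \<Rightarrow> 'a) \<times> (nat \<Rightarrow> 'a)"
  where "G_tau k \<tau> F = (\<lambda>(X, U).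
    if \<tau> 1 = 1
    then (\<lambda>j\<in>{1..k}. if j = 1 then F X else shift \<tau> X U j,
          \<lambda>j\<in>{1..k}. if j = 1 then F U else shift \<tau> U X j)
    else (\<lambda>j\<in>{1..k}. if j = 1 then F U else shift \<tau> X U j,
          \<lambda>j\<in>{1..k}. if j = 1 then F X else shift \<tau> U X j))"

lemma le_tau_antisym:
  assumes "\<tau> \<in> {1..k} \<rightarrow> {-1, 1}" "X \<in> tuples k" "Y \<in> tuples k"
    and "le_tau k \<tau> X Y" "le_tau k \<tau> Y X"
  shows "X = Y"
proof (rule PiE_ext)
  show "X \<in> {1..k} \<rightarrow>\<^sub>E UNIV" "Y \<in> {1..k} \<rightarrow>\<^sub>E UNIV"
    using assms(2,3) by (auto simp: tuples_def)
  fix i assume i: "i \<in> {1..k}"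
  then have "\<tau> i = -1 \<or> \<tau> i = 1"
    using assms(1) by blast
  then show "X i = Y i"
    using i assms(4,5) unfolding le_tau_def by (metis order.antisym)
qed

lemma partial_order_le_lambda:
  assumes "\<tau> \<in> {1..k} \<rightarrow> {-1, 1}"
  shows "partial_order_on (tuples k \<times> tuples k)
    {(P, Q). P \<in> tuples k \<times> tuples k \<and> Q \<in> tuples k \<times> tuples k \<and> le_lambda k \<tau> P Q}"
proof -
  have refl: "le_tau k \<tau> X X" for X :: "nat \<Rightarrow> 'a"
    by (simp add: le_tau_def)
  have trans: "le_tau k \<tau> X Z" if "le_tau k \<tau> X Y" "le_tau k \<tau> Y Z" for X Y Z :: "nat \<Rightarrow> 'a"
    using that unfolding le_tau_def by (meson order.trans)
  show ?thesis
    unfolding partial_order_on_def preorder_on_def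
    by (auto simp: refl_on_def le_lambda_def refl
        intro!: transI antisymI intro: trans le_tau_antisym[OF assms])
qed

end

theory Submission
  imports Defs
begin

text \<open>Exchanging the two arguments of \<open>G_tau\<close> exchanges its components, and
  \<open>le_lambda\<close> reverses the order on the second one. Hence a single comparison,
  \<open>le_tau_shift\<close>, used twice with the roles of the two arguments swapped, handles both
  components. It works because \<open>G_tau\<close> takes a shifted entry from the argument whose
  inequality already points the way that the sign at the new position demands; the first entry is
  handled by monotonicity of \<open>F\<close>.\<close>

lemma le_tau_shift:
  assumes \<tau>: "\<tau> \<in> {1..k} \<rightarrow> {-1, 1}"
    and X: "le_tau k \<tau> X X'" and U: "le_tau k \<tau> U' U"
    and a: "\<tau> 1 = 1 \<Longrightarrow> a \<le> a'" "\<tau> 1 = -1 \<Longrightarrow> a' \<le> a"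
  shows "le_tau k \<tau> (\<lambda>j\<in>{1..k}. if j = 1 then a else shift \<tau> X U j)
    (\<lambda>j\<in>{1..k}. if j = 1 then a' else shift \<tau> X' U' j)"
proof -
  have "(\<tau> j = 1 \<longrightarrow> shift \<tau> X U j \<le> shift \<tau> X' U' j) \<and>
      (\<tau> j = -1 \<longrightarrow> shift \<tau> X U j \<ge> shift \<tau> X' U' j)" if "j \<in> {1..k}" "j \<noteq> 1" for j
  proof -
    \<comment> \<open>Equal signs at \<open>j - 1\<close> and \<open>j\<close>: the entry comes from
      \<open>X\<close>, and the direction of the inequality is kept. Opposite signs: it comes from
      \<open>U\<close>, where the reversed hypothesis on \<open>U\<close> and the change of sign
      cancel.\<close>
    have j: "j - 1 \<in> {1..k}"
      using that by auto
    then have "\<tau> (j - 1) = -1 \<or> \<tau> (j - 1) = 1"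
      using \<tau> by blast
    then show ?thesis
      using j X U unfolding le_tau_def shift_def by auto
  qed
  then show ?thesis
    using a by (auto simp: le_tau_def)
qed

theorem proposition2p7:
  fixes k :: nat and \<tau> :: "nat \<Rightarrow> int" and F :: "(nat \<Rightarrow> 'a::order) \<Rightarrow> 'a"
  assumes "k \<ge> 1"
    and "\<tau> \<in> {1..k} \<rightarrow> {-1, 1}"
    and "monotone_on (tuples k) (le_tau k \<tau>) (\<le>) F"
  shows "G_tau k \<tau> F \<in> tuples k \<times> tuples k \<rightarrow> tuples k \<times> tuples k \<and>
    monotone_on (tuples k \<times> tuples k) (le_lambda k \<tau>) (le_lambda k \<tau>) (G_tau k \<tau> F)"
proof (intro conjI monotone_onI)
  show "G_tau k \<tau> F \<in> tuples k \<times> tuples k \<rightarrow> tuples k \<times> tuples k"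
    by (auto simp: G_tau_def tuples_def)
next
  fix P Q :: "(nat \<Rightarrow> 'a) \<times> (nat \<Rightarrow> 'a)"
  assume "P \<in> tuples k \<times> tuples k" "Q \<in> tuples k \<times> tuples k" "le_lambda k \<tau> P Q"
  then obtain X U Y W where PQ: "P = (X, U)" "Q = (Y, W)"
    and mem: "X \<in> tuples k" "U \<in> tuples k" "Y \<in> tuples k" "W \<in> tuples k"
    and le: "le_tau k \<tau> X Y" "le_tau k \<tau> W U"
    by (auto simp: le_lambda_def)
  have F: "F X \<le> F Y" "F W \<le> F U"
    using monotone_onD[OF assms(3)] mem le by auto
  show "le_lambda k \<tau> (G_tau k \<tau> F P) (G_tau k \<tau> F Q)"
  proof (cases "\<tau> 1 = 1")
    case True
    then show ?thesis
      \<comment> \<open>The second instance runs from \<open>(W, Y)\<close> to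
        \<open>(U, X)\<close>: second components are compared from \<open>Q\<close> to
        \<open>P\<close>.\<close>
      using le_tau_shift[OF assms(2) le, of "F X" "F Y"]
        le_tau_shift[OF assms(2) le(2,1), of "F W" "F U"] F
      by (simp add: PQ G_tau_def le_lambda_def)
  next
    \<comment> \<open>Position 1 now carries a reversed inequality, so the values of
      \<open>F\<close> are swapped: \<open>F W \<le> F U\<close> serves the first component and
      \<open>F X \<le> F Y\<close> the second.\<close>
    case False
    then show ?thesis
      using le_tau_shift[OF assms(2) le, of "F U" "F W"]
        le_tau_shift[OF assms(2) le(2,1), of "F Y" "F X"] F
      by (simp add: PQ G_tau_def le_lambda_def)
  qed
qed

end
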